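(* Consider the transition kernel of the generalized Ornstein–Uhlenbeck (GOU) process, given by $$p(\mathbf{z},T\mid\mathbf{x}_t,t)=\mathcal{N}(\mathbf{z};\bar{\boldsymbol{\mu}}_{t:T},\bar{\sigma}_{t:T}^2\mathbf{I}),$$ where $\bar{\boldsymbol{\mu}}_{t:T}$ and $\bar{\sigma}_{t:T}^2$ denote the conditional mean and variance of the state at time $T$ given $\mathbf{x}_t$, respectively. Let $q(\mathbf{z}):=\mathcal{N}(\mathbf{z};\hat{\mathbf{x}},\hat{\sigma}^2\mathbf{I})$ be a Gaussian density with parameters $\hat{\mathbf{x}}\in\mathbb{R}^d$ and $\hat{\sigma}>0$. Define the function $h(\mathbf{x}_t,t)$ via the integral $$h(\mathbf{x}_t,t):=\int p(\mathbf{z},T\mid\mathbf{x}_t,t)\,q(\mathbf{z})\,\mathrm{d}\mathbf{z}.$$ For any $t\in[0,T]$, $h(\mathbf{x}_t,t)$ admits the closed-form expression $$h(\mathbf{x}_t,t)=\frac{1}{[2\pi(\hat{\sigma}^2+\bar{\sigma}_{t:T}^2)]^{d/2}}\exp\left[-\frac{\|\bar{\boldsymbol{\mu}}_{t:T}-\hat{\mathbf{x}}\|^2}{2(\hat{\sigma}^2+\bar{\sigma}_{t:T}^2)}\right].$$ Furthermore, for any $t\in[0,T)$, $h(\mathbf{x}_t,t)$ evolves according to the Kolmogorov backward equation $$-\frac{\partial h(\mathbf{x}_t,t)}{\partial t}=\theta_t(\boldsymbol{\mu}-\mathbf{x}_t)\cdot\nabla_{\mathbf{x}_t}h(\mathbf{x}_t,t)+\frac12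 g_t^2\,\Delta_{\mathbf{x}_t}h(\mathbf{x}_t,t).$$
   Context: $\mathcal{N}(\mathbf{x};\mathbf{m},s^2\mathbf{I})$ denotes the density at $\mathbf{x}\in\mathbb{R}^d$ of the Gaussian with mean $\mathbf{m}$ and covariance $s^2\mathbf{I}$. The GOU process on $[0,T]$ is governed by $\mathrm{d}\mathbf{x}_t=\theta_t(\boldsymbol{\mu}-\mathbf{x}_t)\,\mathrm{d}t+g_t\,\mathrm{d}\mathbf{w}_t$, where $\boldsymbol{\mu}\in\mathbb{R}^d$ is a given state vector, $\theta_t>0$ is a time-varying scalar drift coefficient, $g_t$ is the time-varying scalar diffusion coefficient, and $\mathbf{w}_t$ is a standard $d$-dimensional Wiener process. Its conditional mean and variance are $$\bar{\boldsymbol{\mu}}_{t:T}=e^{-\bar{\theta}_{t:T}}\mathbf{x}_t+(1-e^{-\bar{\theta}_{t:T}})\boldsymbol{\mu},\qquad \bar{\sigma}_{t:T}^2=\int_t^T e^{-2\bar{\theta}_{u:T}}g_u^2\,\mathrm{d}u,\qquad \bar{\theta}_{s:t}:=\int_s^t\theta_u\,\mathrm{d}u.$$ In the Kolmogorov backward equation, $\mathbf{x}_t$ is treated as a free variable in $\mathbb{R}^d$ (held fixed in $\partial/\partial t$). At $t=T$ the function $h$ is understood through the boundary condition $h(\mathbf{x},T)=q(\mathbf{x})$.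
   Formalization: The coefficients θ and g are assumed continuous on [0,T] (at a jump of g the time derivative of h can fail to exist), and the variance σ̄²_{t:T} is assumed positive for t<T so that the kernel is a density; the time derivative at t=0 is one-sided. *)

theory Defs
  imports "HOL-Analysis.Analysis"
begin

text \<open>The second argument of \<open>gaussian\<close> is the variance \<open>v = s\<^sup>2\<close>, not the
  standard deviation: \<open>gaussian m v x\<close> is the density at \<open>x\<close> of the Gaussian with mean \<open>m\<close> and
  covariance \<open>v I\<close>. It is meaningful only for \<open>v > 0\<close>.\<close>

definition gaussian :: "'a::euclidean_space \<Rightarrow> real \<Rightarrow> 'a \<Rightarrow> real" where
  "gaussian m v x = 1 / (2 * pi * v) powr (real DIM('a) / 2) * exp (- (norm (x - m))\<^sup>2 / (2 * v))"

definition theta_bar :: "(real \<Rightarrow> real) \<Rightarrow> real \<Rightarrow> real \<Rightarrow> real" where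
  "theta_bar \<theta> s t = integral {s..t} \<theta>"

definition gou_mean :: "(real \<Rightarrow> real) \<Rightarrow> 'a::euclidean_space \<Rightarrow> real \<Rightarrow> 'a \<Rightarrow> real \<Rightarrow> 'a" where
  "gou_mean \<theta> \<mu> T x t =
     exp (- theta_bar \<theta> t T) *\<^sub>R x + (1 - exp (- theta_bar \<theta> t T)) *\<^sub>R \<mu>"

definition gou_var :: "(real \<Rightarrow> real) \<Rightarrow> (real \<Rightarrow> real) \<Rightarrow> real \<Rightarrow> real \<Rightarrow> real" where
  "gou_var \<theta> g T t = integral {t..T} (\<lambda>u. exp (- 2 * theta_bar \<theta> u T) * (g u)\<^sup>2)"

text \<open>The transition density \<open>p (z, T | x, t)\<close>.\<close>

definition gou_kernel ::
  "(real \<Rightarrow> real) \<Rightarrow> (real \<Rightarrow> real) \<Rightarrow> 'a::euclidean_space \<Rightarrow> real \<Rightarrow> 'a \<Rightarrow> real \<Rightarrow> 'a \<Rightarrow> real" where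
  "gou_kernel \<theta> g \<mu> T x t z = gaussian (gou_mean \<theta> \<mu> T x t) (gou_var \<theta> g T t) z"

text \<open>At \<open>t = T\<close> the kernel degenerates to a point mass and has no density; there \<open>h\<close> is
  given by its boundary condition.\<close>

definition gou_h ::
  "(real \<Rightarrow> real) \<Rightarrow> (real \<Rightarrow> real) \<Rightarrow> 'a::euclidean_space \<Rightarrow> real \<Rightarrow> ('a \<Rightarrow> real) \<Rightarrow> 'a \<Rightarrow> real \<Rightarrow> real"
  where
  "gou_h \<theta> g \<mu> T q x t =
     (if t = T then q x else (\<integral>z. gou_kernel \<theta> g \<mu> T x t z * q z \<partial>lborel))"

text \<open>\<open>has_laplacian f L x\<close>: the pure second partial derivatives of \<open>f\<close> at \<open>x\<close> exist and sum up
  to \<open>L\<close>. Here \<open>D1 b s\<close> is the first partial derivative in direction \<open>b\<close> at the point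
  \<open>x + s b\<close>, required to exist for \<open>s\<close> near \<open>0\<close>.\<close>

definition has_laplacian :: "('a::euclidean_space \<Rightarrow> real) \<Rightarrow> real \<Rightarrow> 'a \<Rightarrow> bool" where
  "has_laplacian f L x \<longleftrightarrow>
     (\<exists>D1 D2.
        (\<forall>b\<in>Basis.
           (\<forall>\<^sub>F s in nhds 0. ((\<lambda>r. f (x + r *\<^sub>R b)) has_real_derivative D1 b s) (at s)) \<and>
           (D1 b has_real_derivative D2 b) (at 0)) \<and>
        L = (\<Sum>b\<in>Basis. D2 b))"

end

theory Submission imports Defs "HOL-Probability.Distributions" begin

text \<open>A Gaussian density with covariance \<open>v I\<close> is a product of one-dimensional ones, so \<open>h\<close> is a
  product of one-dimensional convolutions. For the backward equation write \<open>a = exp (- theta_bar \<theta> t T)\<close>: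
  then \<open>h\<close> is a Gaussian density evaluated at a point affine in \<open>x\<close> with slope \<open>a\<close>, and the time
  derivatives \<open>\<theta> a (x - \<mu>)\<close> of the mean and \<open>- a\<^sup>2 g\<^sup>2\<close> of the variance produce
  the drift and the diffusion term, respectively, since Gaussian densities solve the heat equation in
  their variance.\<close>

section \<open>Integral of a product of two Gaussian densities\<close>

lemma gaussian_eq_prod:
  fixes m x :: "'a::euclidean_space"
  assumes "0 < v"
  shows "gaussian m v x = (\<Prod>b\<in>Basis. normal_density (m \<bullet> b) (sqrt v) (x \<bullet> b))"
proof -
  have norm_sq: "(norm (x - m))\<^sup>2 = (\<Sum>b\<in>Basis. (x \<bullet> b - m \<bullet> b)\<^sup>2)"
    by (subst power2_norm_eq_inner, subst euclidean_inner)
       (simp add: inner_diff_left power2_eq_square)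
  \<comment> \<open>A natural power of a square root can be distributed over the basis, one
    normalising factor per coordinate.\<close>
  have "(2 * pi * v) powr (real DIM('a) / 2) = ((2 * pi * v) powr (1/2)) powr real DIM('a)"
    by (simp add: powr_powr)
  also have "\<dots> = sqrt (2 * pi * v) ^ DIM('a)"
    using assms by (simp add: powr_half_sqrt powr_realpow)
  finally have "gaussian m v x = (1 / sqrt (2 * pi * v)) ^ DIM('a) *
      exp (\<Sum>b\<in>Basis. - (x \<bullet> b - m \<bullet> b)\<^sup>2 / (2 * v))"
    by (simp add: gaussian_def norm_sq power_divide sum_divide_distrib sum_negf)
  also have "\<dots> = (\<Prod>b\<in>Basis. normal_density (m \<bullet> b) (sqrt v) (x \<bullet> b))"
    using assms by (simp add: normal_density_def exp_sum prod.distrib prod_dividef power_divide)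
  finally show ?thesis .
qed

text \<open>Shifting \<open>z\<close> by \<open>b\<close> and using that centred densities are even
  turns the integrand into that of a convolution of two centred densities at \<open>a - b\<close>,
  where variances add.\<close>

lemma nn_integral_normal_density_mult:
  assumes "0 < \<sigma>" "0 < \<tau>"
  shows "(\<integral>\<^sup>+z. ennreal (normal_density a \<sigma> z * normal_density b \<tau> z) \<partial>lborel) =
    ennreal (normal_density b (sqrt (\<sigma>\<^sup>2 + \<tau>\<^sup>2)) a)"
proof -
  have "(\<integral>\<^sup>+z. ennreal (normal_density a \<sigma> z * normal_density b \<tau> z) \<partial>lborel) =
      (\<integral>\<^sup>+z. ennreal (normal_density a \<sigma> (b + z) * normal_density b \<tau> (b + z)) \<partial>lborel)"
    by (subst lborel_distr_plus[of b, symmetric], subst nn_integral_distr) simp_all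
  also have "\<dots> =
      (\<integral>\<^sup>+z. ennreal (normal_density 0 \<sigma> ((a - b) - z) * normal_density 0 \<tau> z) \<partial>lborel)"
    by (intro nn_integral_cong)
       (simp add: normal_density_def power2_commute[of "b + _" a] diff_diff_eq)
  also have "\<dots> = ennreal (normal_density 0 (sqrt (\<sigma>\<^sup>2 + \<tau>\<^sup>2)) (a - b))"
    using fun_cong[OF conv_normal_density_zero_mean[OF assms]] .
  also have "\<dots> = ennreal (normal_density b (sqrt (\<sigma>\<^sup>2 + \<tau>\<^sup>2)) a)"
    by (simp add: normal_density_def)
  finally show ?thesis .
qed

lemma integral_gaussian_mult:
  fixes m n :: "'a::euclidean_space"
  assumes "0 < v" "0 < w"
  shows "(\<integral>z. gaussian m v z * gaussian n w z \<partial>lborel) = gaussian n (v + w) m"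
proof -
  have [measurable]: "gaussian k u \<in> borel_measurable borel" for k :: 'a and u
    by (simp add: gaussian_def [abs_def])
  have nonneg: "0 \<le> gaussian k u z" for k z :: 'a and u
    by (simp add: gaussian_def)
  \<comment> \<open>For nonnegative integrals the factorisation over coordinates needs no
    integrability; nonnegativity of the integrand carries the value back to the Bochner integral at
    the end.\<close>
  have "(\<integral>\<^sup>+z. ennreal (gaussian m v z * gaussian n w z) \<partial>lborel) =
      (\<integral>\<^sup>+z. (\<Prod>b\<in>Basis. ennreal (normal_density (m \<bullet> b) (sqrt v) (z \<bullet> b) *
        normal_density (n \<bullet> b) (sqrt w) (z \<bullet> b))) \<partial>lborel)"
    using assms by (simp add: gaussian_eq_prod prod.distrib[symmetric] prod_ennreal)
  also have "\<dots> = (\<Prod>b\<in>Basis. \<integral>\<^sup>+z. ennreal (normal_density (m \<bullet> b) (sqrt v) z *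
        normal_density (n \<bullet> b) (sqrt w) z) \<partial>lborel)"
    by (rule nn_integral_lborel_prod) simp_all
  also have "\<dots> = ennreal (gaussian n (v + w) m)"
    using assms by (simp add: nn_integral_normal_density_mult gaussian_eq_prod prod_ennreal)
  finally show ?thesis
    by (simp add: integral_eq_nn_integral nonneg)
qed

section \<open>Derivatives of a Gaussian density in space and along a moving mean and
  variance\<close>

text \<open>With the normalising factor moved into the exponent, every derivative, in space or in
  time, is the density times the derivative of the exponent.\<close>

lemma gaussian_eq_exp:
  fixes n x :: "'a::euclidean_space"
  assumes "0 < v"
  shows "gaussian n v x =
    exp (- (real DIM('a) / 2) * ln (2 * pi * v) - ((x - n) \<bullet> (x - n)) / (2 * v))"
proof -
  have "gaussian n v x =
      exp (- (real DIM('a) / 2 * ln (2 * pi * v))) * exp (- ((x - n) \<bullet> (x - n) / (2 * v)))"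
    using assms by (simp add: gaussian_def powr_def exp_minus power2_norm_eq_inner field_simps)
  then show ?thesis
    by (simp add: mult_exp_exp)
qed

lemma GDERIV_gaussian_affine:
  fixes n c x :: "'a::euclidean_space"
  assumes "0 < v"
  shows "GDERIV (\<lambda>y. gaussian n v (a *\<^sub>R y + c)) x :>
    (- (a / v) * gaussian n v (a *\<^sub>R x + c)) *\<^sub>R (a *\<^sub>R x + c - n)"
proof -
  let ?m = "\<lambda>y. a *\<^sub>R y + c - n"
  have "GDERIV (\<lambda>y. ?m y \<bullet> ?m y) x :> (2 * a) *\<^sub>R ?m x"
    unfolding gderiv_def
    by (auto intro!: derivative_eq_intros simp: fun_eq_iff inner_commute)
  \<comment> \<open>The outer function of the chain rule: \<open>r\<close> stands for the squared
    distance \<open>?m x \<bullet> ?m x\<close>.\<close>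
  moreover have "((\<lambda>r. exp (- (real DIM('a) / 2) * ln (2 * pi * v) - r / (2 * v)))
      has_real_derivative - (1 / (2 * v)) * gaussian n v (a *\<^sub>R x + c)) (at (?m x \<bullet> ?m x))"
    unfolding gaussian_eq_exp[OF assms]
    by (rule derivative_eq_intros refl | use assms in simp)+
  ultimately have "GDERIV (\<lambda>y. gaussian n v (a *\<^sub>R y + c)) x :>
      (- (1 / (2 * v)) * gaussian n v (a *\<^sub>R x + c)) *\<^sub>R ((2 * a) *\<^sub>R ?m x)"
    unfolding gaussian_eq_exp[OF assms] by (rule GDERIV_DERIV_compose)
  then show ?thesis
    by (simp add: mult.commute[of a])
qed

text \<open>Supplies the first partial derivatives that \<open>has_laplacian\<close> requires at
  points \<open>x + s *\<^sub>R b\<close> near \<open>x\<close>.\<close>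

lemma GDERIV_imp_DERIV_line:
  assumes "GDERIV f (x + s *\<^sub>R b) :> G"
  shows "((\<lambda>r. f (x + r *\<^sub>R b)) has_real_derivative b \<bullet> G) (at s)"
proof -
  have "((\<lambda>r. x + r *\<^sub>R b) has_derivative (\<lambda>r. r *\<^sub>R b)) (at s)"
    by (auto intro!: derivative_eq_intros)
  from has_derivative_compose[OF this assms[unfolded gderiv_def]]
  show ?thesis
    by (simp add: has_field_derivative_def mult.commute[of _ "b \<bullet> G"])
qed

lemma has_laplacian_gaussian_affine:
  fixes n c x :: "'a::euclidean_space" and a v :: real
  assumes "0 < v"
  defines "m \<equiv> a *\<^sub>R x + c - n"
  shows "has_laplacian (\<lambda>y. gaussian n v (a *\<^sub>R y + c))
    (gaussian n v (a *\<^sub>R x + c) * (a\<^sup>2 * (m \<bullet> m) / v\<^sup>2 - real DIM('a) * a\<^sup>2 / v)) x"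
proof -
  define F where "F y = gaussian n v (a *\<^sub>R y + c)" for y
  define G where "G y = (- (a / v) * F y) *\<^sub>R (a *\<^sub>R y + c - n)" for y
  have G: "GDERIV F y :> G y" for y
    unfolding F_def [abs_def] G_def by (rule GDERIV_gaussian_affine[OF assms(1)])
  \<comment> \<open>Product rule for \<open>- (a / v) * F * (m \<bullet> b)\<close> in direction
    \<open>b\<close>: differentiating \<open>F\<close> gives the quadratic term, differentiating the
    affine factor gives \<open>- a\<^sup>2 / v\<close>.\<close>
  define D2 where "D2 b = F x * (a\<^sup>2 * (m \<bullet> b)\<^sup>2 / v\<^sup>2 - a\<^sup>2 / v)" for b
  have D1: "((\<lambda>r. F (x + r *\<^sub>R b)) has_real_derivative b \<bullet> G (x + s *\<^sub>R b)) (at s)" for b s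
    by (rule GDERIV_imp_DERIV_line[OF G])
  have D2: "((\<lambda>s. b \<bullet> G (x + s *\<^sub>R b)) has_real_derivative D2 b) (at 0)" if "b \<in> Basis" for b
  proof -
    \<comment> \<open>Since \<open>b \<bullet> b = 1\<close>, the \<open>b\<close>-coordinate of the
      affine argument moves at rate \<open>a\<close> along the line.\<close>
    have "b \<bullet> (a *\<^sub>R (x + s *\<^sub>R b) + c - n) = m \<bullet> b + s * a" for s
      using that by (simp add: m_def inner_commute algebra_simps)
    then have eq: "b \<bullet> G (x + s *\<^sub>R b) = - (a / v) * F (x + s *\<^sub>R b) * (m \<bullet> b + s * a)" for s
      by (simp only: G_def inner_scaleR_right)
    have F': "((\<lambda>s. F (x + s *\<^sub>R b)) has_real_derivative - (a / v) * F x * (m \<bullet> b)) (at 0)"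
      using D1[of b 0] eq[of 0] by simp
    show ?thesis
      unfolding eq
      by (rule DERIV_cong, (rule derivative_eq_intros F' refl)+)
         (use assms(1) in \<open>simp add: D2_def power2_eq_square field_simps\<close>)
  qed
  have "(\<Sum>b\<in>Basis. D2 b) = F x * (a\<^sup>2 * (\<Sum>b\<in>Basis. (m \<bullet> b)\<^sup>2) / v\<^sup>2 - real DIM('a) * a\<^sup>2 / v)"
    by (simp add: D2_def sum_distrib_left[symmetric] sum_subtractf sum_divide_distrib[symmetric])
  also have "(\<Sum>b\<in>Basis. (m \<bullet> b)\<^sup>2) = m \<bullet> m"
    by (subst euclidean_inner) (simp add: power2_eq_square)
  finally have L: "F x * (a\<^sup>2 * (m \<bullet> m) / v\<^sup>2 - real DIM('a) * a\<^sup>2 / v) = (\<Sum>b\<in>Basis. D2 b)" ..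
  have "has_laplacian F (\<Sum>b\<in>Basis. D2 b) x"
    unfolding has_laplacian_def
    by (rule exI[of _ "\<lambda>b s. b \<bullet> G (x + s *\<^sub>R b)"], rule exI[of _ D2]) (simp add: D1 D2)
  then show ?thesis
    unfolding L[symmetric] by (simp add: F_def [abs_def])
qed

text \<open>The three summands come from the normalising factor, the motion of \<open>m\<close>, and
  the variance in the exponent, in this order. Positivity on all of \<open>S\<close> lets the
  exponential form replace the density throughout \<open>S\<close>, so any radius, here 1, serves
  for the transfer.\<close>

lemma has_real_derivative_gaussian_moving:
  fixes n :: "'a::euclidean_space"
  assumes "\<And>s. s \<in> S \<Longrightarrow> 0 < v s" "t \<in> S"
    and v: "(v has_real_derivative v') (at t within S)"
    and m: "(m has_vector_derivative m') (at t within S)"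
  shows "((\<lambda>s. gaussian n (v s) (m s)) has_real_derivative
    gaussian n (v t) (m t) * (- real DIM('a) * v' / (2 * v t) - ((m t - n) \<bullet> m') / v t
      + ((m t - n) \<bullet> (m t - n)) * v' / (2 * (v t)\<^sup>2))) (at t within S)"
proof -
  have vt: "0 < v t" by (rule assms(1)[OF assms(2)])
  have inner: "((\<lambda>s. (m s - n) \<bullet> (m s - n)) has_real_derivative 2 * ((m t - n) \<bullet> m'))
      (at t within S)"
    using m unfolding has_vector_derivative_def has_field_derivative_def
    by (auto intro!: derivative_eq_intros simp: fun_eq_iff inner_commute algebra_simps)
  have "((\<lambda>s. exp (- (real DIM('a) / 2) * ln (2 * pi * v s) - ((m s - n) \<bullet> (m s - n)) / (2 * v s)))
      has_real_derivative gaussian n (v t) (m t) * (- real DIM('a) * v' / (2 * v t)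
      - ((m t - n) \<bullet> m') / v t + ((m t - n) \<bullet> (m t - n)) * v' / (2 * (v t)\<^sup>2))) (at t within S)"
    using vt unfolding gaussian_eq_exp[OF vt]
    by (auto intro!: derivative_eq_intros v inner simp: power2_eq_square field_simps)
  then show ?thesis
    by (rule has_field_derivative_transform_within[OF _ zero_less_one \<open>t \<in> S\<close>])
       (simp add: gaussian_eq_exp assms(1))
qed

section \<open>Time derivatives of the coefficients of the GOU process\<close>

lemma theta_bar_has_derivative:
  assumes "continuous_on {0..T} \<theta>" "t \<in> {0..T}"
  shows "((\<lambda>s. theta_bar \<theta> s T) has_real_derivative - \<theta> t) (at t within {0..T})"
  unfolding theta_bar_def by (rule integral_has_real_derivative'[OF assms])

text \<open>The weight \<open>theta_bar \<theta> u T\<close> ends at \<open>T\<close> and does not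
  involve the lower limit of the outer integral, so the derivative is just minus the integrand at
  that limit.\<close>

lemma gou_var_has_derivative:
  assumes "continuous_on {0..T} \<theta>" "continuous_on {0..T} g" "t \<in> {0..T}"
  shows "((\<lambda>s. gou_var \<theta> g T s) has_real_derivative
    - (exp (- theta_bar \<theta> t T))\<^sup>2 * (g t)\<^sup>2) (at t within {0..T})"
proof -
  have "continuous_on {0..T} (\<lambda>s. theta_bar \<theta> s T)"
    using theta_bar_has_derivative[OF assms(1)] by (rule DERIV_continuous_on)
  then have "continuous_on {0..T} (\<lambda>u. exp (- 2 * theta_bar \<theta> u T) * (g u)\<^sup>2)"
    by (intro continuous_intros assms)
  from integral_has_real_derivative'[OF this assms(3)]
  show ?thesis
    by (simp add: gou_var_def [abs_def] exp_double[symmetric])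
qed

text \<open>The coefficients of \<open>x\<close> and \<open>\<mu>\<close> sum to 1, so their rates
  of change are opposite and only \<open>x - \<mu>\<close> remains.\<close>

lemma gou_mean_has_derivative:
  assumes "continuous_on {0..T} \<theta>" "t \<in> {0..T}"
  shows "((\<lambda>s. gou_mean \<theta> \<mu> T x s) has_vector_derivative
    (\<theta> t * exp (- theta_bar \<theta> t T)) *\<^sub>R (x - \<mu>)) (at t within {0..T})"
  unfolding gou_mean_def
  using theta_bar_has_derivative[OF assms]
  by (auto intro!: derivative_eq_intros simp: algebra_simps)

section \<open>Closed form of \<open>h\<close> and the backward equation\<close>

theorem theorem3p3:
  fixes \<theta> g :: "real \<Rightarrow> real"
    and T \<sigma>hat :: real
    and \<mu> xhat :: "real ^ 'n"
  defines "q \<equiv> gaussian xhat (\<sigma>hat\<^sup>2)"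
  defines "h \<equiv> gou_h \<theta> g \<mu> T q"
  assumes "0 < T"
    and "continuous_on {0..T} \<theta>"
    and "continuous_on {0..T} g"
    and "\<And>t. t \<in> {0..T} \<Longrightarrow> 0 < \<theta> t"
    and "\<And>t. t \<in> {0..<T} \<Longrightarrow> 0 < gou_var \<theta> g T t"
    and "0 < \<sigma>hat"
  shows "(\<forall>t\<in>{0..T}. \<forall>x.
            h x t = 1 / (2 * pi * (\<sigma>hat\<^sup>2 + gou_var \<theta> g T t)) powr (real CARD('n) / 2) *
              exp (- (norm (gou_mean \<theta> \<mu> T x t - xhat))\<^sup>2 / (2 * (\<sigma>hat\<^sup>2 + gou_var \<theta> g T t))))
       \<and> (\<forall>t\<in>{0..<T}. \<forall>x. \<exists>ht G L.
            ((\<lambda>s. h x s) has_real_derivative ht) (at t within {0..T}) \<and>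
            GDERIV (\<lambda>y. h y t) x :> G \<and>
            has_laplacian (\<lambda>y. h y t) L x \<and>
            - ht = \<theta> t * ((\<mu> - x) \<bullet> G) + 1 / 2 * (g t)\<^sup>2 * L)"
proof -
  define v where "v t = \<sigma>hat\<^sup>2 + gou_var \<theta> g T t" for t
  \<comment> \<open>At \<open>t = T\<close> the integrals run over a single point, so the closed
    form reduces to the boundary value \<open>q x\<close>.\<close>
  have var_T: "gou_var \<theta> g T T = 0" and mean_T: "gou_mean \<theta> \<mu> T x T = x" for x
    by (simp_all add: gou_var_def gou_mean_def theta_bar_def)
  have v_pos: "0 < v t" if "t \<in> {0..T}" for t
    using that assms(7)[of t] \<open>0 < \<sigma>hat\<close> var_T
    by (cases "t = T") (auto simp: v_def add_pos_pos)
  have h_eq: "h x t = gaussian xhat (v t) (gou_mean \<theta> \<mu> T x t)" if "t \<in> {0..T}" for x t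
  proof (cases "t = T")
    case True
    then show ?thesis
      by (simp add: h_def q_def gou_h_def v_def var_T mean_T)
  next
    case False
    then show ?thesis
      using that assms(7)[of t] \<open>0 < \<sigma>hat\<close>
      by (simp add: h_def q_def gou_h_def v_def gou_kernel_def integral_gaussian_mult add.commute)
  qed
  have "\<exists>ht G L.
      ((\<lambda>s. h x s) has_real_derivative ht) (at t within {0..T}) \<and>
      GDERIV (\<lambda>y. h y t) x :> G \<and>
      has_laplacian (\<lambda>y. h y t) L x \<and>
      - ht = \<theta> t * ((\<mu> - x) \<bullet> G) + 1 / 2 * (g t)\<^sup>2 * L" if "t \<in> {0..<T}" for t x
  proof -
    have t: "t \<in> {0..T}" using that by simp
    define a where "a = exp (- theta_bar \<theta> t T)"
    define c where "c = (1 - a) *\<^sub>R \<mu>"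
    define m where "m = a *\<^sub>R x + c - xhat"
    \<comment> \<open>The moving-Gaussian derivative with
      \<open>m' = (\<theta> t * a) *\<^sub>R (x - \<mu>)\<close> and
      \<open>v' = - a\<^sup>2 * (g t)\<^sup>2\<close>; \<open>G\<close> and \<open>L\<close> below
      are the gradient and Laplacian of the affine Gaussian.\<close>
    define ht where "ht = h x t * (real CARD('n) * a\<^sup>2 * (g t)\<^sup>2 / (2 * v t)
      - \<theta> t * a * (m \<bullet> (x - \<mu>)) / v t - (m \<bullet> m) * a\<^sup>2 * (g t)\<^sup>2 / (2 * (v t)\<^sup>2))"
    define G where "G = (- (a / v t) * h x t) *\<^sub>R m"
    define L where "L = h x t * (a\<^sup>2 * (m \<bullet> m) / (v t)\<^sup>2 - real CARD('n) * a\<^sup>2 / v t)"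
    have mean: "gou_mean \<theta> \<mu> T y t = a *\<^sub>R y + c" for y
      by (simp add: gou_mean_def a_def c_def)
    have h_t: "h y t = gaussian xhat (v t) (a *\<^sub>R y + c)" for y
      by (simp add: h_eq[OF t] mean)
    have v': "(v has_real_derivative - a\<^sup>2 * (g t)\<^sup>2) (at t within {0..T})"
      unfolding v_def [abs_def] a_def
      using gou_var_has_derivative[OF assms(4,5) t] by (auto intro!: derivative_eq_intros)
    have "((\<lambda>s. gaussian xhat (v s) (gou_mean \<theta> \<mu> T x s)) has_real_derivative ht)
        (at t within {0..T})"
      by (rule DERIV_cong[OF has_real_derivative_gaussian_moving[OF v_pos t v'
          gou_mean_has_derivative[OF assms(4) t]]])
         (simp_all add: ht_def h_t mean m_def[symmetric] a_def[symmetric])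
    \<comment> \<open>The closed form holds on \<open>{0..T}\<close>, which suffices because the
      derivative is taken within that interval; at \<open>t = 0\<close> it is one-sided.\<close>
    then have "((\<lambda>s. h x s) has_real_derivative ht) (at t within {0..T})"
      by (rule has_field_derivative_transform_within[OF _ zero_less_one t]) (simp add: h_eq)
    moreover have "GDERIV (\<lambda>y. h y t) x :> G"
      unfolding h_t G_def m_def by (rule GDERIV_gaussian_affine[OF v_pos[OF t]])
    moreover have "has_laplacian (\<lambda>y. h y t) L x"
      using has_laplacian_gaussian_affine[OF v_pos[OF t], of xhat a c x]
      by (simp add: h_t L_def m_def)
    \<comment> \<open>The mean-motion term of \<open>- ht\<close> is exactly the drift term. The two
      terms stemming from \<open>v'\<close> are \<open>1 / 2 * (g t)\<^sup>2 * L\<close>, since both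
      carry the factor \<open>a\<^sup>2 * (g t)\<^sup>2 / 2\<close>.\<close>
    moreover have "- ht = \<theta> t * ((\<mu> - x) \<bullet> G) + 1 / 2 * (g t)\<^sup>2 * L"
    proof -
      have "(\<mu> - x) \<bullet> G = a / v t * h x t * (m \<bullet> (x - \<mu>))"
        using v_pos[OF t]
        by (simp add: G_def inner_diff_left inner_diff_right inner_commute field_simps)
      then show ?thesis
        using v_pos[OF t] by (simp add: ht_def L_def field_simps)
    qed
    ultimately show ?thesis by blast
  qed
  then show ?thesis
    by (simp add: h_eq v_def gaussian_def)
qed

end
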